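(* Let $\mathbb{S}=(\mathbb{F}_q,+,\star)$ be a presemifield of even order $q$, and let $\mathcal{O}=\{(f(y),y):y\in\mathbb{F}_q\}\cup\{(0),(\alpha)\}$ be a hyperoval in $\Pi(\mathbb{S})$, where $\alpha\in\mathbb{F}_q^*$ and $f$ is a two-to-one additive map on $\mathbb{F}_q$ with $f(0)=0$. Let $\theta$ be the unique nonzero element of $\mathbb{F}_q$ with $f(\theta)=0$. Then the orbit $\{\varphi(\mathcal{O}):\varphi\in\Sigma\}$ consists of $q^2$ hyperovals. If there exists $v\in\mathbb{F}_q$ with $f(v)\star\alpha=\theta$, then any two such hyperovals meet in $0$, $2$, $4$ or $6$ points; otherwise any two such hyperovals meet in $0$, $2$ or $4$ points.
   Context: A presemifield $(\mathbb{S},+,\star)$ of order $q$ is taken with underlying set $\mathbb{F}_q$, field addition, and a distributive multiplication $\star$ without zero divisors. The plane $\Pi(\mathbb{S})$ has affine points $(a,b)$, points at infinity $(a)$, $a\in\mathbb{F}_q\cup\{\infty\}$, and lines: the line at infinity; $l_a=\{(a,y):y\in\mathbb{F}_q\}\cup\{(\infty)\}$ for $a\in\mathbb{F}_q$; $l_{a,b}=\{(x,y):y=x\star a+b\}\cup\{(a)\}$. A hyperoval is a set of $q+2$ points no three collinear. The translation $\tau_{a,b}$ maps $(x,y)\mapsto(x+a,y+b)$ and fixes all points at infinity; the shear $\sigma_c$ maps $(x,y)\mapsto(x,y+x\star c)$, $(z)\mapsto(z+c)$ for $z\in\mathbb{F}_q$, $(\infty)\mapsto(\infty)$. $\Sigma$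 is the collineation group generated by all $\tau_{a,b}$ and $\sigma_c$.
   Formalization: The claim that the orbit consists of q^2 hyperovals is stated only for q > 4, since it fails for q = 2 and q = 4 (e.g. q = 4, f(y) = y^2+y, α = 1 gives an orbit of 8); the other claims are stated for every even q. *)

theory Defs
  imports Complex_Main "HOL-Library.Cardinality" "HOL-Algebra.Generated_Groups" "HOL-Algebra.Bij"
begin

text \<open>The field \<open>\<F>\<^sub>q\<close> is an arbitrary type of sort \<open>{finite,field}\<close>, with \<open>q = CARD('a)\<close>.
  A presemifield multiplication need not be commutative, associative or unital, and it is
  unrelated to the multiplication of the field.\<close>

definition presemifield :: "('a::{finite,field} \<Rightarrow> 'a \<Rightarrow> 'a) \<Rightarrow> bool" where
  "presemifield star \<longleftrightarrow>
     (\<forall>x y z. star x (y + z) = star x y + star x z) \<and>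
     (\<forall>x y z. star (x + y) z = star x z + star y z) \<and>
     (\<forall>x y. star x y = 0 \<longrightarrow> x = 0 \<or> y = 0)"

text \<open>\<open>Aff x y\<close> is the affine point \<open>(x, y)\<close>, \<open>Slope a\<close> is the point at infinity \<open>(a)\<close> for
  \<open>a \<in> \<F>\<^sub>q\<close>, and \<open>Infty\<close> is the point at infinity \<open>(\<infinity>)\<close>.\<close>

datatype 'a point = Aff 'a 'a | Slope 'a | Infty

definition line_at_infinity :: "'a point set" where
  "line_at_infinity = range Slope \<union> {Infty}"

definition vertical_line :: "'a \<Rightarrow> 'a point set" where
  "vertical_line a = {Aff a y | y. True} \<union> {Infty}"

definition slope_line :: "('a::{finite,field} \<Rightarrow> 'a \<Rightarrow> 'a) \<Rightarrow> 'a \<Rightarrow> 'a \<Rightarrow> 'a point set" where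
  "slope_line star a b = {Aff x y | x y. y = star x a + b} \<union> {Slope a}"

definition plane_lines :: "('a::{finite,field} \<Rightarrow> 'a \<Rightarrow> 'a) \<Rightarrow> 'a point set set" where
  "plane_lines star =
     {line_at_infinity} \<union> range vertical_line \<union> {slope_line star a b | a b. True}"

definition collinear3 ::
    "('a::{finite,field} \<Rightarrow> 'a \<Rightarrow> 'a) \<Rightarrow> 'a point \<Rightarrow> 'a point \<Rightarrow> 'a point \<Rightarrow> bool" where
  "collinear3 star P Q R \<longleftrightarrow> (\<exists>l\<in>plane_lines star. P \<in> l \<and> Q \<in> l \<and> R \<in> l)"

definition hyperoval :: "('a::{finite,field} \<Rightarrow> 'a \<Rightarrow> 'a) \<Rightarrow> 'a point set \<Rightarrow> bool" where
  "hyperoval star H \<longleftrightarrow>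
     card H = CARD('a) + 2 \<and>
     (\<forall>P\<in>H. \<forall>Q\<in>H. \<forall>R\<in>H. P \<noteq> Q \<and> P \<noteq> R \<and> Q \<noteq> R \<longrightarrow> \<not> collinear3 star P Q R)"

fun translation :: "'a::{finite,field} \<Rightarrow> 'a \<Rightarrow> 'a point \<Rightarrow> 'a point" where
  "translation a b (Aff x y) = Aff (x + a) (y + b)"
| "translation a b (Slope z) = Slope z"
| "translation a b Infty = Infty"

fun shear :: "('a::{finite,field} \<Rightarrow> 'a \<Rightarrow> 'a) \<Rightarrow> 'a \<Rightarrow> 'a point \<Rightarrow> 'a point" where
  "shear star c (Aff x y) = Aff x (y + star x c)"
| "shear star c (Slope z) = Slope (z + c)"
| "shear star c Infty = Infty"

text \<open>The subgroup is generated inside the group of all permutations of the point set. All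
  generators are collineations (see \<open>translation_collineation\<close> and \<open>shear_collineation\<close>), so it
  coincides with the subgroup they generate in the collineation group.\<close>

definition Sigma_group ::
    "('a::{finite,field} \<Rightarrow> 'a \<Rightarrow> 'a) \<Rightarrow> ('a point \<Rightarrow> 'a point) set" where
  "Sigma_group star =
     generate (BijGroup UNIV) ({translation a b | a b. True} \<union> {shear star c | c. True})"

definition Sigma_orbit ::
    "('a::{finite,field} \<Rightarrow> 'a \<Rightarrow> 'a) \<Rightarrow> 'a point set \<Rightarrow> 'a point set set" where
  "Sigma_orbit star H = {\<phi> ` H | \<phi>. \<phi> \<in> Sigma_group star}"

definition two_to_one :: "('a \<Rightarrow> 'b) \<Rightarrow> bool" where
  "two_to_one f \<longleftrightarrow> (\<forall>y\<in>range f. card (f -` {y}) = 2)"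

definition collineation ::
    "('a::{finite,field} \<Rightarrow> 'a \<Rightarrow> 'a) \<Rightarrow> ('a point \<Rightarrow> 'a point) \<Rightarrow> bool" where
  "collineation star \<phi> \<longleftrightarrow> bij \<phi> \<and> (`) \<phi> ` plane_lines star = plane_lines star"

lemma translation_inverse:
  "translation (-a) (-b) (translation a b P) = P"
  "translation a b (translation (-a) (-b) P) = P"
  by (cases P; simp)+

lemma shear_inverse:
  assumes "presemifield star"
  shows "shear star (-c) (shear star c P) = P" "shear star c (shear star (-c) P) = P"
proof -
  have d: "star x (y + z) = star x y + star x z" for x y z
    using assms by (simp add: presemifield_def)
  have z: "star x 0 = 0" for x using d[of x 0 0] by (metis add_cancel_right_right add_0)
  have "star x c + star x (-c) = 0" for x using d[of x c "-c"] z by simp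
  then have n: "star x (-c) = - star x c" for x by (metis add_eq_0_iff)
  show "shear star (-c) (shear star c P) = P" by (cases P) (simp_all add: n)
  show "shear star c (shear star (-c) P) = P" by (cases P) (simp_all add: n)
qed

lemma collineationI:
  assumes "\<And>P. \<psi> (\<phi> P) = P" "\<And>P. \<phi> (\<psi> P) = P"
    and "\<And>l. l \<in> plane_lines star \<Longrightarrow> \<phi> ` l \<in> plane_lines star"
    and "\<And>l. l \<in> plane_lines star \<Longrightarrow> \<psi> ` l \<in> plane_lines star"
  shows "collineation star \<phi>"
proof -
  have "bij \<phi>" using assms(1,2) by (metis bijI')
  moreover have "l \<in> (`) \<phi> ` plane_lines star" if "l \<in> plane_lines star" for l
  proof
    show "l = \<phi> ` (\<psi> ` l)" using assms(2) by (simp add: image_image)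
    show "\<psi> ` l \<in> plane_lines star" using assms(4) that .
  qed
  ultimately show ?thesis unfolding collineation_def using assms(3) by auto
qed

lemma translation_line:
  fixes star :: "'a::{finite,field} \<Rightarrow> 'a \<Rightarrow> 'a"
  assumes "presemifield star" "l \<in> plane_lines star"
  shows "translation a b ` l \<in> plane_lines star"
proof -
  have d: "star (x + y) z = star x z + star y z" for x y z
    using assms by (simp add: presemifield_def)
  consider "l = line_at_infinity" | c where "l = vertical_line c" |
    m k where "l = slope_line star m k"
    using assms(2) by (auto simp: plane_lines_def)
  then show ?thesis
  proof cases
    case 1
    have "translation a b ` l = line_at_infinity"
      unfolding 1 line_at_infinity_def by (force simp: image_iff)
    then show ?thesis by (simp add: plane_lines_def)
  next
    case 2
    have "Aff (c + a) y \<in> translation a b ` l" for y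
      unfolding 2 vertical_line_def by (rule image_eqI[of _ _ "Aff c (y - b)"]) auto
    moreover have "Infty \<in> translation a b ` l"
      unfolding 2 vertical_line_def by (rule image_eqI[of _ _ Infty]) auto
    ultimately have "translation a b ` l = vertical_line (c + a)"
      unfolding 2 vertical_line_def by auto
    then show ?thesis by (simp add: plane_lines_def)
  next
    case 3
    have "Aff x (star x m + (k + b - star a m)) \<in> translation a b ` l" for x
    proof (rule image_eqI)
      show "Aff x (star x m + (k + b - star a m)) =
          translation a b (Aff (x - a) (star (x - a) m + k))"
        using d[of "x - a" a m] by (simp add: algebra_simps)
      show "Aff (x - a) (star (x - a) m + k) \<in> l"
        unfolding 3 slope_line_def by auto
    qed
    moreover have "Slope m \<in> translation a b ` l"
      unfolding 3 slope_line_def by (rule image_eqI[of _ _ "Slope m"]) auto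
    ultimately have "translation a b ` l = slope_line star m (k + b - star a m)"
      unfolding 3 slope_line_def by (auto simp: d)
    then show ?thesis by (auto simp: plane_lines_def)
  qed
qed

lemma shear_line:
  fixes star :: "'a::{finite,field} \<Rightarrow> 'a \<Rightarrow> 'a"
  assumes "presemifield star" "l \<in> plane_lines star"
  shows "shear star c ` l \<in> plane_lines star"
proof -
  have d: "star x (y + z) = star x y + star x z" for x y z
    using assms by (simp add: presemifield_def)
  consider "l = line_at_infinity" | a where "l = vertical_line a" |
    m k where "l = slope_line star m k"
    using assms(2) by (auto simp: plane_lines_def)
  then show ?thesis
  proof cases
    case 1
    have "Slope z \<in> shear star c ` l" for z
      unfolding 1 line_at_infinity_def by (rule image_eqI[of _ _ "Slope (z - c)"]) auto
    moreover have "Infty \<in> shear star c ` l"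
      unfolding 1 line_at_infinity_def by (rule image_eqI[of _ _ Infty]) auto
    ultimately have "shear star c ` l = line_at_infinity"
      unfolding 1 line_at_infinity_def by auto
    then show ?thesis by (simp add: plane_lines_def)
  next
    case 2
    have "Aff a y \<in> shear star c ` l" for y
      unfolding 2 vertical_line_def by (rule image_eqI[of _ _ "Aff a (y - star a c)"]) auto
    moreover have "Infty \<in> shear star c ` l"
      unfolding 2 vertical_line_def by (rule image_eqI[of _ _ Infty]) auto
    ultimately have "shear star c ` l = vertical_line a"
      unfolding 2 vertical_line_def by auto
    then show ?thesis by (simp add: plane_lines_def)
  next
    case 3
    have "Aff x (star x (m + c) + k) \<in> shear star c ` l" for x
      unfolding 3 slope_line_def
      by (rule image_eqI[of _ _ "Aff x (star x m + k)"]) (auto simp: d algebra_simps)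
    moreover have "Slope (m + c) \<in> shear star c ` l"
      unfolding 3 slope_line_def by (rule image_eqI[of _ _ "Slope m"]) auto
    ultimately have "shear star c ` l = slope_line star (m + c) k"
      unfolding 3 slope_line_def by (auto simp: d algebra_simps)
    then show ?thesis by (auto simp: plane_lines_def)
  qed
qed

lemma translation_collineation:
  "presemifield star \<Longrightarrow> collineation star (translation a b)"
  by (rule collineationI[of "translation (-a) (-b)"]) (simp_all add: translation_inverse translation_line)

lemma shear_collineation:
  "presemifield star \<Longrightarrow> collineation star (shear star c)"
  by (rule collineationI[of "shear star (-c)"]) (simp_all add: shear_inverse shear_line)

end

theory Submission
  imports Defs
begin

text \<open>Every element of \<open>\<Sigma>\<close> is a translation composed with a shear, so the orbit consists of the
  sets \<open>T\<^sub>c + u\<close> together with \<open>(c)\<close> and \<open>(c + \<alpha>)\<close>, where \<open>T\<^sub>c\<close> is the additive group of the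
  points \<open>(f(y), y + f(y) \<star> c)\<close>. Eliminating one of the two parameters, the affine points common to
  two members correspond to a fibre of the additive map \<open>y \<mapsto> f(f(y) \<star> d)\<close>, where \<open>d\<close> is the
  difference of the two shear parameters. If \<open>d \<noteq> 0\<close>, the kernel of this map consists of the two
  zeros of \<open>f\<close> and of the solutions of \<open>f(y) \<star> d = \<theta>\<close>, of which there are none or two. The points at
  infinity contribute two further points precisely if \<open>d \<in> {0, \<alpha>}\<close>. For \<open>q > 4\<close> the kernel is a
  proper subgroup, so distinct \<open>c\<close> give distinct sets, and each set arises from \<open>q\<close> of the \<open>q\<^sup>3\<close>
  elements of \<open>\<Sigma>\<close>.\<close>

section \<open>The group of translations and shears\<close>

locale presemifield_mult =
  fixes star :: "'a::{finite,field} \<Rightarrow> 'a \<Rightarrow> 'a" (infixl \<open>\<star>\<close> 70)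
  assumes presemifield: "presemifield star"
begin

lemma star_add_right: "x \<star> (y + z) = x \<star> y + x \<star> z"
  and star_add_left: "(x + y) \<star> z = x \<star> z + y \<star> z"
  and star_eq_0D: "x \<star> y = 0 \<Longrightarrow> x = 0 \<or> y = 0"
  using presemifield by (auto simp: presemifield_def)

lemma star_0_right [simp]: "x \<star> 0 = 0"
  using star_add_right[of x 0 0] by (metis add_cancel_right_right add_0)

lemma star_0_left [simp]: "0 \<star> x = 0"
  using star_add_left[of 0 0 x] by (metis add_cancel_right_right add_0)

lemma star_diff_right: "x \<star> (y - z) = x \<star> y - x \<star> z"
  using star_add_right[of x "y - z" z] by (simp add: algebra_simps)

lemma star_diff_left: "(x - y) \<star> z = x \<star> z - y \<star> z"
  using star_add_left[of "x - y" y z] by (simp add: algebra_simps)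

lemma star_cancel_right: "x \<star> z = y \<star> z \<longleftrightarrow> x = y" if "z \<noteq> 0"
  using star_diff_left[of x y z] star_eq_0D[of "x - y" z] that by auto

definition affinity :: "'a \<Rightarrow> 'a \<Rightarrow> 'a \<Rightarrow> 'a point \<Rightarrow> 'a point" where
  "affinity a b c = translation a b \<circ> shear star c"

lemma affinity_simps [simp]:
  "affinity a b c (Aff x y) = Aff (x + a) (y + x \<star> c + b)"
  "affinity a b c (Slope z) = Slope (z + c)"
  "affinity a b c Infty = Infty"
  by (simp_all add: affinity_def)

text \<open>A shear moves past a translation at the cost of a vertical shift: shearing by
  \<open>c\<close> after translating by \<open>(a', b')\<close> equals shearing by \<open>c\<close>
  and then translating by \<open>(a', b' + a' \<star> c)\<close>.\<close>

lemma affinity_comp: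
  "affinity a b c \<circ> affinity a' b' c' = affinity (a + a') (b + b' + a' \<star> c) (c + c')"
proof
  show "(affinity a b c \<circ> affinity a' b' c') P = affinity (a + a') (b + b' + a' \<star> c) (c + c') P" for P
    by (cases P) (simp_all add: star_add_left star_add_right algebra_simps)
qed

lemma affinity_translation: "affinity a b 0 = translation a b"
proof
  show "affinity a b 0 P = translation a b P" for P by (cases P) simp_all
qed

lemma affinity_shear: "affinity 0 0 c = shear star c"
proof
  show "affinity 0 0 c P = shear star c P" for P by (cases P) simp_all
qed

lemma affinity_0: "affinity 0 0 0 = id"
proof
  show "affinity 0 0 0 P = id P" for P by (cases P) simp_all
qed

lemma affinity_collineation: "collineation star (affinity a b c)"
proof -
  have "(`) (affinity a b c) ` L = (`) (translation a b) ` (`) (shear star c) ` L" for L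
    by (simp add: affinity_def image_image image_comp)
  then show ?thesis
    using translation_collineation[OF presemifield, of a b] shear_collineation[OF presemifield, of c]
    by (simp add: collineation_def affinity_def bij_comp)
qed

lemma bij_affinity: "bij (affinity a b c)"
  using affinity_collineation by (simp add: collineation_def)

section \<open>Identification of \<open>Sigma_group\<close>\<close>

lemma carrier_BijGroup_UNIV: "\<phi> \<in> carrier (BijGroup UNIV) \<longleftrightarrow> bij \<phi>"
  by (simp add: BijGroup_def Bij_def)

lemma one_BijGroup_UNIV: "\<one>\<^bsub>BijGroup UNIV\<^esub> = id"
  by (simp add: BijGroup_def fun_eq_iff)

text \<open>The multiplication of \<open>BijGroup\<close> is a function restricted to bijections, so
  it unfolds to plain composition only for bijective arguments.\<close>

lemma mult_BijGroup_UNIV: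
  "bij \<phi> \<Longrightarrow> bij \<psi> \<Longrightarrow> \<phi> \<otimes>\<^bsub>BijGroup UNIV\<^esub> \<psi> = \<phi> \<circ> \<psi>"
  by (simp add: BijGroup_def Bij_def compose_def fun_eq_iff)

lemmas BijGroup_UNIV = carrier_BijGroup_UNIV one_BijGroup_UNIV mult_BijGroup_UNIV

lemma subgroup_affinity: "subgroup {affinity a b c | a b c. True} (BijGroup UNIV)"
proof (rule group.subgroupI[OF group_BijGroup])
  show "{affinity a b c | a b c. True} \<subseteq> carrier (BijGroup UNIV)"
    by (auto simp: BijGroup_UNIV bij_affinity)
  show "{affinity a b c | a b c. True} \<noteq> {}" by blast
next
  fix \<phi> assume "\<phi> \<in> {affinity a b c | a b c. True}"
  then obtain a b c where \<phi>: "\<phi> = affinity a b c" by blast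
  \<comment> \<open>Solves \<open>affinity_comp\<close> for zero parameters; the middle entry
    amounts to \<open>- b + a \<star> c\<close>.\<close>
  let ?\<psi> = "affinity (- a) (- b - (- a) \<star> c) (- c)"
  have "?\<psi> \<circ> \<phi> = id"
    unfolding \<phi> affinity_comp
    using star_diff_left[of 0 a c] star_diff_right[of a 0 c]
    by (simp add: affinity_0)
  then have "inv\<^bsub>BijGroup UNIV\<^esub> \<phi> = ?\<psi>"
    by (intro group.inv_equality[OF group_BijGroup])
      (simp_all add: BijGroup_UNIV bij_affinity \<phi>)
  then show "inv\<^bsub>BijGroup UNIV\<^esub> \<phi> \<in> {affinity a b c | a b c. True}" by blast
next
  fix \<phi> \<psi> assume "\<phi> \<in> {affinity a b c | a b c. True}" "\<psi> \<in> {affinity a b c | a b c. True}"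
  then show "\<phi> \<otimes>\<^bsub>BijGroup UNIV\<^esub> \<psi> \<in> {affinity a b c | a b c. True}"
    by (auto simp: BijGroup_UNIV bij_affinity affinity_comp) blast
qed

text \<open>The affinities form a subgroup that contains the generators, and each of them is a
  product of two generators.\<close>

lemma Sigma_group_eq: "Sigma_group star = {affinity a b c | a b c. True}"
proof
  show "Sigma_group star \<subseteq> {affinity a b c | a b c. True}"
    unfolding Sigma_group_def
    by (intro group.generate_subgroup_incl[OF group_BijGroup _ subgroup_affinity])
      (use affinity_translation[symmetric] affinity_shear[symmetric] in blast)
  show "{affinity a b c | a b c. True} \<subseteq> Sigma_group star"
  proof clarify
    fix a b c
    have t: "translation a b \<in> Sigma_group star" and s: "shear star c \<in> Sigma_group star"
      unfolding Sigma_group_def by (auto intro!: generate.incl)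
    have "affinity a b c = translation a b \<otimes>\<^bsub>BijGroup UNIV\<^esub> shear star c"
      using bij_affinity[of a b 0] bij_affinity[of 0 0 c]
      unfolding affinity_translation affinity_shear by (simp add: mult_BijGroup_UNIV affinity_def)
    then show "affinity a b c \<in> Sigma_group star"
      using t s unfolding Sigma_group_def by (auto intro: generate.eng)
  qed
qed

section \<open>Hyperovals under collineations\<close>

lemma hyperoval_collineation:
  assumes \<phi>: "collineation star \<phi>" and H: "hyperoval star H"
  shows "hyperoval star (\<phi> ` H)"
proof -
  have inj: "inj \<phi>" and lines: "(`) \<phi> ` plane_lines star = plane_lines star"
    using \<phi> by (auto simp: collineation_def bij_def)
  have "collinear3 star P Q R" if col: "collinear3 star (\<phi> P) (\<phi> Q) (\<phi> R)" for P Q R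
  proof -
    from col obtain l' where "l' \<in> plane_lines star" and PQR: "\<phi> ` {P, Q, R} \<subseteq> l'"
      unfolding collinear3_def by auto
    \<comment> \<open>Every line is the image of a line, so collinearity of image points pulls back
      along the injective \<open>\<phi>\<close>.\<close>
    then obtain l where "l \<in> plane_lines star" "l' = \<phi> ` l"
      using lines by (metis imageE)
    with PQR have "l \<in> plane_lines star" "\<phi> ` {P, Q, R} \<subseteq> \<phi> ` l" by simp_all
    then show ?thesis
      unfolding collinear3_def inj_image_subset_iff[OF inj] by auto
  qed
  moreover have "card (\<phi> ` H) = card H"
    using inj by (simp add: card_image inj_on_subset)
  ultimately show ?thesis
    using H unfolding hyperoval_def Ball_image_comp comp_def inj_eq[OF inj] by metis
qed

end

section \<open>The orbit\<close>

text \<open>A nonempty fibre is a coset of the kernel.\<close>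

lemma card_fibre_additive:
  fixes h :: "'a::{finite,ab_group_add} \<Rightarrow> 'b::ab_group_add"
  assumes "Modules.additive h" "h y\<^sub>0 = e"
  shows "card {y. h y = e} = card {y. h y = 0}"
proof -
  have "{y. h y = e} = (\<lambda>z. z + y\<^sub>0) ` {y. h y = 0}"
  proof (intro Set.set_eqI iffI)
    fix y assume "y \<in> {y. h y = e}"
    then show "y \<in> (\<lambda>z. z + y\<^sub>0) ` {y. h y = 0}"
      using assms by (intro image_eqI[of _ _ "y - y\<^sub>0"]) (auto simp: additive.diff)
  qed (use assms in \<open>auto simp: additive.add\<close>)
  then show ?thesis by (simp add: card_image)
qed

locale additive_oval = presemifield_mult +
  fixes f :: "'a \<Rightarrow> 'a" and \<alpha> \<theta> :: 'a
  assumes additive: "Modules.additive f"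
    and two_to_one: "two_to_one f"
    and \<alpha>_nonzero: "\<alpha> \<noteq> 0"
    and \<theta>_def: "\<theta> = (THE t. t \<noteq> 0 \<and> f t = 0)"
begin

section \<open>The kernel of \<open>f\<close>\<close>

lemmas f_add = additive.add[OF additive] and f_diff = additive.diff[OF additive]
  and f_0 = additive.zero[OF additive]

lemma card_f_fibre: "card {y. f y = f v} = 2"
  using two_to_one unfolding two_to_one_def vimage_def by auto

lemma ex1_kernel: "\<exists>!t. t \<noteq> 0 \<and> f t = 0"
proof -
  obtain u v where "{y. f y = 0} = {u, v}" "u \<noteq> v"
    using card_f_fibre[of 0] by (auto simp: f_0 card_2_iff)
  then have "f y = 0 \<longleftrightarrow> y = u \<or> y = v" for y by auto
  with \<open>u \<noteq> v\<close> show ?thesis using f_0 by metis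
qed

lemma \<theta>_nonzero: "\<theta> \<noteq> 0" and f_eq_0_iff: "f t = 0 \<longleftrightarrow> t = 0 \<or> t = \<theta>"
  using theI'[OF ex1_kernel] ex1_kernel f_0 unfolding \<theta>_def[symmetric] by auto

text \<open>The kernel \<open>{0, \<theta>}\<close> is closed under negation, so
  \<open>- \<theta> = \<theta>\<close>; field division by \<open>\<theta>\<close> then gives
  \<open>1 + 1 = 0\<close>.\<close>

lemma char_2: "x + x = (0::'a)"
proof -
  have "f (- \<theta>) = 0" using additive.minus[OF additive, of \<theta>] f_eq_0_iff by simp
  then have "\<theta> + \<theta> = 0" using f_eq_0_iff[of "- \<theta>"] \<theta>_nonzero by (metis add.left_inverse neg_equal_0_iff_equal)
  then have "(1 + 1) * \<theta> = 0" by (simp add: distrib_right)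
  then have "(1 + 1) * x = 0" using \<theta>_nonzero by (simp del: one_add_one)
  then show ?thesis by (simp add: distrib_right del: one_add_one)
qed

section \<open>Parametrization of the orbit members\<close>

definition curve :: "'a \<Rightarrow> 'a \<Rightarrow> 'a \<Rightarrow> 'a \<Rightarrow> 'a point" where
  "curve a b c y = Aff (f y + a) (y + f y \<star> c + b)"

definition oval :: "'a \<Rightarrow> 'a \<Rightarrow> 'a \<Rightarrow> 'a point set" where
  "oval a b c = range (curve a b c) \<union> {Slope c, Slope (c + \<alpha>)}"

lemma affinity_image:
  "affinity a b c ` ({Aff (f y) y | y. True} \<union> {Slope 0, Slope \<alpha>}) = oval a b c"
  unfolding oval_def image_Un
  by (intro arg_cong2[of _ _ _ _ "(\<union>)"])
    (auto simp: curve_def image_iff add.commute intro!: exI)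

text \<open>The first coordinate determines \<open>f y\<close>, after which the second determines
  \<open>y\<close>.\<close>

lemma inj_curve: "inj (curve a b c)"
  by (auto simp: inj_on_def curve_def)

lemma curve_mem_iff:
  "curve a b c y \<in> range (curve a' b' c') \<longleftrightarrow>
    f (f y \<star> (c - c')) = a - a' - f (b - b' - (a - a') \<star> c')" (is "_ \<longleftrightarrow> ?R")
proof -
  \<comment> \<open>The second coordinate determines the parameter \<open>y'\<close> on the other
    curve. Substituting it into the condition on \<open>f y'\<close> and expanding by additivity
    cancels \<open>f y\<close>.\<close>
  have eq: "f (y + f y \<star> c + b - (f y + a - a') \<star> c' - b') = f y + a - a' \<longleftrightarrow> ?R"
    by (simp add: star_add_left star_diff_left star_diff_right f_add f_diff) (auto simp: algebra_simps)
  have "curve a b c y = curve a' b' c' y' \<longleftrightarrow>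
      f y' = f y + a - a' \<and> y' = y + f y \<star> c + b - (f y + a - a') \<star> c' - b'" for y'
  proof (cases "f y' = f y + a - a'")
    case True
    show ?thesis unfolding curve_def True by (auto simp: algebra_simps)
  next
    case False
    then show ?thesis by (auto simp: curve_def algebra_simps)
  qed
  then have "curve a b c y \<in> range (curve a' b' c') \<longleftrightarrow>
      (\<exists>y'. f y' = f y + a - a' \<and> y' = y + f y \<star> c + b - (f y + a - a') \<star> c' - b')"
    by (simp add: image_iff)
  with eq show ?thesis by auto
qed

section \<open>Intersection numbers\<close>

lemma additive_f_star: "Modules.additive (\<lambda>y. f (f y \<star> d))"
  by unfold_locales (simp add: f_add star_add_left)

text \<open>The value \<open>f y \<star> d\<close> must be \<open>0\<close> or
  \<open>\<theta>\<close>. Since multiplication by \<open>d\<close> is injective, each value that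
  occurs fixes \<open>f y\<close> and so contributes one two-element fibre of
  \<open>f\<close>.\<close>

lemma kernel_f_star:
  assumes "d \<noteq> 0"
  shows "card {y. f (f y \<star> d) = 0} = (if \<exists>v. f v \<star> d = \<theta> then 4 else 2)"
proof -
  have f_\<theta>: "f \<theta> = 0" by (simp add: f_eq_0_iff)
  have ker: "card {y. f y = 0} = 2" using card_f_fibre[of 0] by (simp add: f_0)
  have *: "{y. f (f y \<star> d) = 0} = {y. f y = 0} \<union> {y. f y \<star> d = \<theta>}"
    using assms by (auto simp: f_eq_0_iff f_0 f_\<theta> dest: star_eq_0D)
  show ?thesis
  proof (cases "\<exists>v. f v \<star> d = \<theta>")
    case True
    then obtain v where "f v \<star> d = \<theta>" by blast
    then have "{y. f y \<star> d = \<theta>} = {y. f y = f v}" using star_cancel_right[OF assms] by metis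
    then have "card {y. f y \<star> d = \<theta>} = 2" using card_f_fibre by simp
    moreover have "{y. f y = 0} \<inter> {y. f y \<star> d = \<theta>} = {}" using \<theta>_nonzero by auto
    ultimately show ?thesis using True ker unfolding * by (simp add: card_Un_disjoint)
  next
    case False
    then show ?thesis using ker unfolding * by simp
  qed
qed

lemma card_curve_inter:
  assumes "c \<noteq> c'"
  shows "card (range (curve a b c) \<inter> range (curve a' b' c')) \<in>
    {0, if \<exists>v. f v \<star> (c - c') = \<theta> then 4 else 2}"
proof -
  define e where "e = a - a' - f (b - b' - (a - a') \<star> c')"
  have "range (curve a b c) \<inter> range (curve a' b' c') = curve a b c ` {y. f (f y \<star> (c - c')) = e}"
    using curve_mem_iff unfolding e_def by blast
  then have card: "card (range (curve a b c) \<inter> range (curve a' b' c')) = card {y. f (f y \<star> (c - c')) = e}"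
    by (simp add: card_image inj_on_subset[OF inj_curve])
  show ?thesis
  proof (cases "\<exists>y. f (f y \<star> (c - c')) = e")
    case True
    then obtain y where "f (f y \<star> (c - c')) = e" by blast
    from card_fibre_additive[OF additive_f_star this] show ?thesis
      using kernel_f_star[of "c - c'"] assms unfolding card by simp
  qed (simp add: card)
qed

text \<open>For a common \<open>c\<close> both ranges are cosets of the same additive group.\<close>

lemma range_curve_cases:
  "range (curve a b c) = range (curve a' b' c) \<or> range (curve a b c) \<inter> range (curve a' b' c) = {}"
proof -
  have "P \<in> range (curve a b c) \<longleftrightarrow> P \<in> range (curve a' b' c)" if Q: "Q \<in> range (curve a b c)" "Q \<in> range (curve a' b' c)" for P Q
  proof -
    from Q obtain y y' where "curve a b c y = curve a' b' c y'" by auto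
    then have *: "a - a' = f y' - f y" "b - b' = y' - y + (f y' - f y) \<star> c"
      by (auto simp: curve_def algebra_simps star_diff_left)
    \<comment> \<open>With equal shear parameters the membership criterion no longer involves
      \<open>z\<close>, so one common point makes it hold for all.\<close>
    have 1: "curve a b c z \<in> range (curve a' b' c)" for z
      unfolding curve_mem_iff * by (simp add: f_0 f_diff)
    have **: "a' - a = f y - f y'" "b' - b = y - y' + (f y - f y') \<star> c"
      using * by (auto simp: algebra_simps star_diff_left)
    have "curve a' b' c z \<in> range (curve a b c)" for z
      unfolding curve_mem_iff ** by (simp add: f_0 f_diff)
    with 1 show ?thesis by blast
  qed
  then show ?thesis by blast
qed

lemma card_oval_inter:
  "card (oval a b c \<inter> oval a' b' c') =
    card (range (curve a b c) \<inter> range (curve a' b' c')) + (if c - c' \<in> {0, \<alpha>} then 2 else 0)"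
proof -
  let ?C = "range (curve a b c) \<inter> range (curve a' b' c')"
  let ?I = "{Slope c, Slope (c + \<alpha>)} \<inter> {Slope c', Slope (c' + \<alpha>)}"
  \<comment> \<open>In characteristic 2, adding \<open>\<alpha>\<close> is an involution, so the two
    pairs of slopes coincide or are disjoint.\<close>
  have neg: "c = c' + \<alpha> \<longleftrightarrow> c' = c + \<alpha>"
    using char_2[of \<alpha>] by (metis add.assoc add.right_neutral)
  have I: "card ?I = (if c - c' \<in> {0, \<alpha>} then 2 else 0)"
  proof (cases "c - c' \<in> {0, \<alpha>}")
    case True
    then have "c = c' \<or> c = c' + \<alpha>" by (auto simp: algebra_simps)
    then have "{Slope c', Slope (c' + \<alpha>)} = {Slope c, Slope (c + \<alpha>)}" using neg by (metis insert_commute)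
    then show ?thesis using True \<alpha>_nonzero by simp
  next
    case False
    then have "c \<noteq> c'" "c \<noteq> c' + \<alpha>" "c' \<noteq> c + \<alpha>" using neg by (simp_all add: algebra_simps)
    then have "?I = {}" by auto
    then show ?thesis using False by simp
  qed
  have "oval a b c \<inter> oval a' b' c' = ?C \<union> ?I" "?C \<inter> ?I = {}"
    unfolding oval_def curve_def by auto
  then show ?thesis using I by (simp add: card_Un_disjoint)
qed

lemma card_oval_inter_cases:
  assumes "oval a b c \<noteq> oval a' b' c'"
  shows "card (oval a b c \<inter> oval a' b' c') \<in> (if \<exists>v. f v \<star> \<alpha> = \<theta> then {0, 2, 4, 6} else {0, 2, 4})"
proof (cases "c = c'")
  case True
  then have "range (curve a b c) \<inter> range (curve a' b' c') = {}"
    using assms range_curve_cases[of a b c a' b'] by (auto simp: oval_def)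
  then show ?thesis using card_oval_inter[of a b c a' b' c'] True by simp
next
  case False
  \<comment> \<open>Six points require four affine ones and \<open>c - c' = \<alpha>\<close>, hence
    a \<open>v\<close> with \<open>f v \<star> \<alpha> = \<theta>\<close>.\<close>
  then show ?thesis
    using card_oval_inter[of a b c a' b' c'] card_curve_inter[OF False, of a b a' b']
    by (auto split: if_splits)
qed

section \<open>Size of the orbit\<close>

lemma oval_eq_iff:
  assumes "CARD('a) > 4"
  shows "oval a' b' c' = oval a b c \<longleftrightarrow> (\<exists>y. (a', b', c') = (a + f y, b + (y + f y \<star> c), c))"
proof
  assume eq: "oval a' b' c' = oval a b c"
  have "range (curve a b c) = oval a b c \<inter> {Aff x y | x y. True}" for a b c
    by (auto simp: oval_def curve_def)
  with eq have range: "range (curve a b c) = range (curve a' b' c')" by simp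
  have "c = c'"
  proof (rule ccontr)
    assume "c \<noteq> c'"
    \<comment> \<open>Different shear parameters leave at most 4 common affine points, whereas equal
      ovals share all \<open>CARD('a)\<close> of them.\<close>
    from card_curve_inter[OF this, of a b a' b'] have "card (range (curve a b c)) \<le> 4"
      unfolding range[symmetric] by (auto split: if_splits)
    then show False using assms by (simp add: card_image inj_curve)
  qed
  \<comment> \<open>At parameter \<open>0\<close> the curve passes through \<open>Aff a' b'\<close>;
    the witness \<open>y\<close> is the parameter of this point on the other curve.\<close>
  moreover have "curve a' b' c' 0 \<in> range (curve a b c)" unfolding range by simp
  ultimately show "\<exists>y. (a', b', c') = (a + f y, b + (y + f y \<star> c), c)"
    by (auto simp: curve_def f_0 algebra_simps)
next
  assume "\<exists>y. (a', b', c') = (a + f y, b + (y + f y \<star> c), c)"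
  then obtain y where "a' = a + f y" "b' = b + (y + f y \<star> c)" and c: "c' = c" by auto
  then have "curve a b c y = curve a' b' c' 0" by (simp add: curve_def f_0 algebra_simps)
  then have "range (curve a b c) \<inter> range (curve a' b' c') \<noteq> {}" by (metis IntI rangeI emptyE)
  then show "oval a' b' c' = oval a b c"
    using range_curve_cases[of a b c a' b'] by (auto simp: oval_def c)
qed

lemma card_ovals:
  assumes "CARD('a) > 4"
  shows "card {oval a b c | a b c. True} = CARD('a) ^ 2"
proof -
  let ?F = "\<lambda>(a, b, c). oval a b c"
  have fibre: "card {p. ?F p = A} = CARD('a)" if A: "A \<in> range ?F" for A
  proof -
    from A obtain a b c where A: "A = oval a b c" by auto
    have "?F p = A \<longleftrightarrow> p \<in> range (\<lambda>y. (a + f y, b + (y + f y \<star> c), c))" for p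
      unfolding A by (cases p) (simp add: image_iff oval_eq_iff[OF assms])
    then have "{p. ?F p = A} = range (\<lambda>y. (a + f y, b + (y + f y \<star> c), c))" by blast
    also have "card \<dots> = CARD('a)" by (intro card_image) (auto simp: inj_on_def)
    finally show ?thesis .
  qed
  \<comment> \<open>Double counting of the parameter triples, grouped by the oval they
    define.\<close>
  have "CARD('a) * CARD('a) ^ 2 = CARD('a \<times> 'a \<times> 'a)"
    by (simp add: power2_eq_square)
  also have "\<dots> = (\<Sum>A\<in>range ?F. card {p. ?F p = A})"
    using sum.image_gen[of UNIV "\<lambda>_. 1::nat" ?F] by simp
  also have "\<dots> = CARD('a) * card (range ?F)" by (simp add: fibre)
  also have "range ?F = {oval a b c | a b c. True}" by (auto simp: image_iff)
  finally show ?thesis by simp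
qed

lemma Sigma_orbit_eq:
  "Sigma_orbit star ({Aff (f y) y | y. True} \<union> {Slope 0, Slope \<alpha>}) = {oval a b c | a b c. True}"
  unfolding Sigma_orbit_def Sigma_group_eq affinity_image[symmetric] by blast

end

theorem theorem5p4:
  fixes star :: "'a::{finite,field} \<Rightarrow> 'a \<Rightarrow> 'a"
    and f :: "'a \<Rightarrow> 'a"
    and \<alpha> \<theta> :: 'a
    and H :: "'a point set"
  assumes "presemifield star"
    and "even CARD('a)"
    and "\<alpha> \<noteq> 0"
    and "Modules.additive f"
    and "two_to_one f"
    and "f 0 = 0"
    and "H = {Aff (f y) y | y. True} \<union> {Slope 0, Slope \<alpha>}"
    and "hyperoval star H"
    and "\<theta> = (THE t. t \<noteq> 0 \<and> f t = 0)"
  shows "(\<exists>!t. t \<noteq> 0 \<and> f t = 0) \<and>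
    (\<forall>A\<in>Sigma_orbit star H. hyperoval star A) \<and>
    (CARD('a) > 4 \<longrightarrow> card (Sigma_orbit star H) = CARD('a) ^ 2) \<and>
    ((\<exists>v. star (f v) \<alpha> = \<theta>) \<longrightarrow>
      (\<forall>A\<in>Sigma_orbit star H. \<forall>B\<in>Sigma_orbit star H.
         A \<noteq> B \<longrightarrow> card (A \<inter> B) \<in> {0, 2, 4, 6})) \<and>
    (\<not> (\<exists>v. star (f v) \<alpha> = \<theta>) \<longrightarrow>
      (\<forall>A\<in>Sigma_orbit star H. \<forall>B\<in>Sigma_orbit star H.
         A \<noteq> B \<longrightarrow> card (A \<inter> B) \<in> {0, 2, 4}))"
proof -
  interpret additive_oval star f \<alpha> \<theta>
    using assms by (intro additive_oval.intro presemifield_mult.intro additive_oval_axioms.intro)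
  note orbit = Sigma_orbit_eq[folded assms(7)]
  have "\<forall>A\<in>Sigma_orbit star H. hyperoval star A"
    unfolding Sigma_orbit_def Sigma_group_eq
    using hyperoval_collineation[OF affinity_collineation assms(8)] by blast
  moreover have "CARD('a) > 4 \<longrightarrow> card (Sigma_orbit star H) = CARD('a) ^ 2"
    unfolding orbit using card_ovals by blast
  \<comment> \<open>The conditional set treats both cases at once and collapses under either
    hypothesis on \<open>v\<close>.\<close>
  moreover have "card (A \<inter> B) \<in> (if \<exists>v. star (f v) \<alpha> = \<theta> then {0, 2, 4, 6} else {0, 2, 4})"
    if "A \<in> Sigma_orbit star H" "B \<in> Sigma_orbit star H" "A \<noteq> B" for A B
    using that unfolding orbit by (elim CollectE exE conjE) (metis card_oval_inter_cases)
  ultimately show ?thesis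
    by (intro conjI ex1_kernel impI ballI) (simp_all only: if_True if_False simp_thms)
qed

end
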